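(* Let $n\ge0$ be an integer and let $Z_n$ be the number of zeros of a random lattice path $P_n$ of length $n$ (chosen according to the model in the context). Then $$\mathbb{E}(Z_n)=\frac{4}{n+1}\sum_{0\le k<\ell<\lceil n/2\rceil}\frac{\binom nk}{\binom n\ell}+[n\text{ even}]\,\frac{1}{n+1}\left(\frac{2^n}{\binom{n}{n/2}}-1\right)+1.$$
   Context: $[\mathit{expr}]$ is $1$ if $\mathit{expr}$ is true and $0$ otherwise (the term with $[n\text{ even}]$ is $0$ for odd $n$). Random path model: for an integer $n\ge0$, a random path $P_n$ on the lattice $\mathbb{Z}^2$ with steps $(1,+1)$ and $(1,-1)$, ending in $(n,0)$, is chosen as follows. First choose a starting point $(0,S)$ with $S$ uniformly distributed in $\{-n,-n+2,\dots,n-2,n\}$. Then choose a path uniformly at random among all paths from $(0,S)$ to $(n,0)$. A zero of $P_n$ is a lattice point $(x,0)\in P_n$ visited by the path (including the starting point if $S=0$ and the end point $(n,0)$). *)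

theory Defs
  imports "HOL-Probability.Probability"
begin

definition lattice_step :: "int \<times> int \<Rightarrow> int \<times> int \<Rightarrow> bool" where
  "lattice_step u v \<longleftrightarrow> v - u \<in> {(1, 1), (1, -1)}"

text \<open>A path is the list of the lattice points it visits, in order. A single point is a
  path of length 0.\<close>

definition lattice_paths :: "int \<times> int \<Rightarrow> int \<times> int \<Rightarrow> (int \<times> int) list set" where
  "lattice_paths u v = {p. p \<noteq> [] \<and> hd p = u \<and> last p = v \<and> successively lattice_step p}"

definition start_heights :: "nat \<Rightarrow> int set" where
  "start_heights n = {- int n + 2 * int i | i. i \<le> n}"

text \<open>Not uniform on all paths of length \<open>n\<close> ending in \<open>(n, 0)\<close>: first the starting height
  is uniform, then the path is uniform given the starting height. Both sets are finite and
  non-empty, so \<^const>\<open>pmf_of_set\<close> is the uniform distribution.\<close>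

definition random_path :: "nat \<Rightarrow> (int \<times> int) list pmf" where
  "random_path n =
     bind_pmf (pmf_of_set (start_heights n))
       (\<lambda>s. pmf_of_set (lattice_paths (0, s) (int n, 0)))"

definition zeros :: "(int \<times> int) list \<Rightarrow> (int \<times> int) set" where
  "zeros p = {z \<in> set p. snd z = 0}"

end

theory Submission
  imports Defs
begin

text \<open>Decomposing at the first step shows that the total number of zeros over all paths with
  \<open>m\<close> steps, \<open>j\<close> of them down, that end on the axis satisfies Pascal's recurrence, with an extra
  term \<open>m choose j\<close> when the path starts on the axis, that is when \<open>2 * j = m\<close>. The solution is
  \<open>m choose j\<close> plus twice the sum of all \<open>m choose k\<close> with \<open>k < min j (m - j)\<close>. Averaging over
  \<open>j\<close> and using the symmetry between \<open>j\<close> and \<open>m - j\<close> gives the formula.\<close>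

section \<open>Structure of lattice paths\<close>

lemma fst_bounds_lattice_path:
  assumes "p \<in> lattice_paths u v" "z \<in> set p"
  shows "fst u \<le> fst z" "fst z \<le> fst v"
proof -
  have "successively lattice_step p \<Longrightarrow> z \<in> set p \<Longrightarrow> fst (hd p) \<le> fst z \<and> fst z \<le> fst (last p)"
  proof (induction p arbitrary: z)
    case (Cons x p)
    show ?case
    proof (cases p)
      case Nil
      with Cons.prems show ?thesis by simp
    next
      case p: (Cons y q)
      have "fst y = fst x + 1"
        using Cons.prems(1) p by (cases x; cases y) (auto simp: lattice_step_def)
      moreover have "fst y \<le> fst (last p)" "z \<in> set p \<Longrightarrow> fst y \<le> fst z \<and> fst z \<le> fst (last p)"
        using Cons.IH[of y] Cons.IH[of z] Cons.prems(1) p by simp_all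
      moreover have "z = x \<or> z \<in> set p" using Cons.prems(2) by simp
      moreover have "last (x # p) = last p" using p by simp
      ultimately show ?thesis by fastforce
    qed
  qed simp
  with assms show "fst u \<le> fst z" "fst z \<le> fst v"
    by (auto simp: lattice_paths_def)
qed

text \<open>The strict inequality rules out the one-point path, so every path has a second point,
  reached by one of the two steps.\<close>

lemma lattice_paths_first_step:
  assumes "fst u < fst v"
  shows "lattice_paths u v =
    Cons u ` (lattice_paths (u + (1, 1)) v \<union> lattice_paths (u + (1, -1)) v)" (is "?L = ?R")
proof (intro set_eqI iffI)
  fix p assume p: "p \<in> ?L"
  then obtain q where q: "p = u # q" by (cases p) (auto simp: lattice_paths_def)
  with p assms have "q \<noteq> []" by (auto simp: lattice_paths_def)
  then obtain w r where r: "q = w # r" by (cases q) auto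
  have "w = u + (1, 1) \<or> w = u + (1, -1)"
    using p q r by (auto simp: lattice_paths_def lattice_step_def algebra_simps)
  then show "p \<in> ?R" using p q r by (auto simp: lattice_paths_def)
next
  fix p assume "p \<in> ?R"
  then show "p \<in> ?L"
    by (auto simp: lattice_paths_def lattice_step_def successively_Cons)
qed

text \<open>A second point would already lie to the right of \<open>v\<close>. This is the base case
  of the later inductions on the number of steps.\<close>

lemma lattice_paths_same_abscissa:
  assumes "fst u = fst v"
  shows "lattice_paths u v = (if u = v then {[u]} else {})"
proof -
  have "p = [u]" if "p \<in> lattice_paths u v" for p
  proof (rule ccontr)
    assume "p \<noteq> [u]"
    moreover from that obtain q where "p = u # q"
      by (cases p) (auto simp: lattice_paths_def)
    ultimately obtain w r where p: "p = u # w # r"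
      by (cases q) auto
    with that have "w # r \<in> lattice_paths w v" "fst w = fst u + 1"
      by (cases u; cases w; auto simp: lattice_paths_def lattice_step_def)+
    with fst_bounds_lattice_path(2)[of "w # r" w v w] assms show False by simp
  qed
  moreover have "[u] \<in> lattice_paths u u"
    by (simp add: lattice_paths_def)
  moreover have "u = v" if "[u] \<in> lattice_paths u v"
    using that by (simp add: lattice_paths_def)
  ultimately show ?thesis by auto
qed

text \<open>The end abscissa is regrouped as \<open>a + 1 + int m\<close> so that induction
  hypotheses apply at \<open>a + 1\<close>.\<close>

lemma lattice_paths_Suc:
  "lattice_paths (a, s) (a + int (Suc m), 0) = Cons (a, s) `
     (lattice_paths (a + 1, s + 1) (a + 1 + int m, 0) \<union>
      lattice_paths (a + 1, s - 1) (a + 1 + int m, 0))"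
  using lattice_paths_first_step[of "(a, s)" "(a + int (Suc m), 0)"] by (simp add: add_ac)

lemma finite_lattice_paths: "finite (lattice_paths (a, s) (a + int m, 0))"
proof (induction m arbitrary: a s)
  case 0
  then show ?case by (simp add: lattice_paths_same_abscissa)
next
  case (Suc m)
  then show ?case unfolding lattice_paths_Suc by blast
qed

text \<open>Each step rises by at most 1. For paths without down steps this eliminates the lower
  successor of the start.\<close>

lemma lattice_paths_too_low:
  "s < - int m \<Longrightarrow> lattice_paths (a, s) (a + int m, 0) = {}"
proof (induction m arbitrary: a s)
  case 0
  then show ?case by (simp add: lattice_paths_same_abscissa)
next
  case (Suc m)
  then show ?case unfolding lattice_paths_Suc by simp
qed

section \<open>Counting paths by their number of down steps\<close>

lemma zeros_Cons:
  "zeros (z # p) = (if snd z = 0 then insert z (zeros p) else zeros p)"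
  by (auto simp: zeros_def)

text \<open>The two families are disjoint because their starting points differ. Constant
  \<open>f\<close> yields the path count, \<open>card (zeros p)\<close> the zero count.\<close>

lemma sum_lattice_paths_Suc:
  fixes f :: "(int \<times> int) list \<Rightarrow> nat"
  shows "(\<Sum>p \<in> lattice_paths (a, s) (a + int (Suc m), 0). f p) =
    (\<Sum>p \<in> lattice_paths (a + 1, s + 1) (a + 1 + int m, 0). f ((a, s) # p)) +
    (\<Sum>p \<in> lattice_paths (a + 1, s - 1) (a + 1 + int m, 0). f ((a, s) # p))"
proof -
  have disj: "lattice_paths (a + 1, s + 1) (a + 1 + int m, 0) \<inter>
      lattice_paths (a + 1, s - 1) (a + 1 + int m, 0) = {}"
    by (auto simp: lattice_paths_def)
  show ?thesis
    unfolding lattice_paths_Suc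
    by (subst sum.reindex)
      (simp_all add: sum.union_disjoint[OF finite_lattice_paths finite_lattice_paths disj])
qed

text \<open>With \<open>j\<close> down steps and \<open>m - j\<close> up steps, ending at height 0
  forces the start height \<open>2 * j - m\<close>. The first-step recurrence is then Pascal's
  rule.\<close>

lemma card_lattice_paths:
  "card (lattice_paths (a, 2 * int j - int m) (a + int m, 0)) = m choose j"
proof (induction m arbitrary: a j)
  case 0
  then show ?case by (cases j) (auto simp: lattice_paths_same_abscissa)
next
  case (Suc m)
  note rec = sum_lattice_paths_Suc[where f = "\<lambda>_. 1", simplified sum_constant]
  show ?case
  proof (cases j)
    case 0
    then show ?thesis
      using rec[of a "- int (Suc m)" m] Suc[of "a + 1" 0]
      by (simp add: lattice_paths_too_low)
  next
    case j: (Suc i)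
    have s: "2 * int j - int (Suc m) + 1 = 2 * int j - int m"
      "2 * int j - int (Suc m) - 1 = 2 * int i - int m"
      using j by simp_all
    show ?thesis
      using rec[of a "2 * int j - int (Suc m)" m, unfolded s] Suc j by (simp del: of_nat_Suc)
  qed
qed

section \<open>Total number of zeros\<close>

definition total_zeros :: "nat \<Rightarrow> nat \<Rightarrow> nat" where
  "total_zeros m j = (m choose j) + 2 * (\<Sum>k<min j (m - j). m choose k)"

text \<open>Pascal's rule summed over \<open>k\<close>; the index shift makes the second sum one
  term shorter.\<close>

lemma sum_choose_Suc:
  "(\<Sum>k<Suc i. Suc m choose k) = (\<Sum>k<Suc i. m choose k) + (\<Sum>k<i. m choose k)"
  by (induction i) simp_all

text \<open>The cases differ in how the upper limits of the three truncated sums compare.\<close>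

lemma total_zeros_Suc:
  "total_zeros (Suc m) (Suc j) =
    of_bool (2 * Suc j = Suc m) * (Suc m choose Suc j) + total_zeros m (Suc j) + total_zeros m j"
proof -
  consider "m < j" | "m = j" | "2 * Suc j \<le> m" | "2 * Suc j = Suc m" | "Suc m < 2 * Suc j" "j < m"
    by linarith
  then show ?thesis
  proof cases
    case 3
    then have "min (Suc j) (Suc m - Suc j) = Suc j" "min (Suc j) (m - Suc j) = Suc j"
      "min j (m - j) = j" by auto
    with 3 show ?thesis unfolding total_zeros_def by (simp only: sum_choose_Suc) simp
  next
    \<comment> \<open>Start on the axis: the left sum is longer by the term
      \<open>m choose j\<close>, counted twice. By symmetry this doubled term equals
      \<open>(m choose Suc j) + (m choose j)\<close>, so \<open>Suc m choose Suc j\<close> remains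
      as the extra term.\<close>
    case 4
    then have m: "m = 2 * j + 1" by simp
    then have mins: "min (Suc j) (Suc m - Suc j) = Suc j" "min (Suc j) (m - Suc j) = j"
      "min j (m - j) = j" by auto
    have "m choose Suc j = m choose j"
      using binomial_symmetric[of j m] m by simp
    with 4 mins show ?thesis unfolding total_zeros_def mins by (simp only: sum_choose_Suc) simp
  next
    \<comment> \<open>Mirror image of case 3: now the sum for \<open>Suc j\<close> is the shorter
      one.\<close>
    case 5
    then obtain i where "m - j = Suc i" by (metis Suc_diff_Suc)
    with 5 have mins: "min (Suc j) (Suc m - Suc j) = Suc i" "min (Suc j) (m - Suc j) = i"
      "min j (m - j) = Suc i" by auto
    from 5 show ?thesis unfolding total_zeros_def mins by (simp only: sum_choose_Suc) simp
  qed (auto simp: total_zeros_def)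
qed

text \<open>The prepended point lies strictly to the left of \<open>p\<close>, so if it is a zero,
  it is a new one.\<close>

lemma sum_card_zeros_Suc:
  "(\<Sum>p \<in> lattice_paths (a + 1, t) (a + 1 + int m, 0). card (zeros ((a, s) # p))) =
    of_bool (s = 0) * card (lattice_paths (a + 1, t) (a + 1 + int m, 0)) +
    (\<Sum>p \<in> lattice_paths (a + 1, t) (a + 1 + int m, 0). card (zeros p))"
proof -
  have "card (zeros ((a, s) # p)) = of_bool (s = 0) + card (zeros p)"
    if "p \<in> lattice_paths (a + 1, t) (a + 1 + int m, 0)" for p
  proof -
    have "(a, s) \<notin> zeros p"
      using fst_bounds_lattice_path(1)[OF that, of "(a, s)"] by (auto simp: zeros_def)
    moreover have "finite (zeros p)" by (simp add: zeros_def)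
    ultimately show ?thesis by (auto simp: zeros_Cons)
  qed
  then show ?thesis by (simp add: sum.distrib)
qed

text \<open>When the start is on the axis, it adds one zero per path; by Pascal's rule the two path
  counts add up to the extra term in \<open>total_zeros_Suc\<close>.\<close>

lemma sum_card_zeros:
  "(\<Sum>p \<in> lattice_paths (a, 2 * int j - int m) (a + int m, 0). card (zeros p)) = total_zeros m j"
proof (induction m arbitrary: a j)
  case 0
  have "zeros [(a, 0)] = {(a, 0)}" by (auto simp: zeros_def)
  then show ?case
    by (cases j) (auto simp: lattice_paths_same_abscissa total_zeros_def)
next
  case (Suc m)
  note rec = sum_lattice_paths_Suc[where f = "\<lambda>p. card (zeros p)", unfolded sum_card_zeros_Suc]
  show ?case
  proof (cases j)
    case 0
    then show ?thesis
      using rec[of a "- int (Suc m)" m] Suc[of "a + 1" 0]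
      by (simp add: lattice_paths_too_low total_zeros_def)
  next
    case j: (Suc i)
    let ?s = "2 * int j - int (Suc m)"
    have s: "?s + 1 = 2 * int j - int m" "?s - 1 = 2 * int i - int m"
      using j by simp_all
    have "?s = 0 \<longleftrightarrow> 2 * Suc i = Suc m" using j by presburger
    with rec[of a ?s m, unfolded s Suc card_lattice_paths] show ?thesis
      using j by (simp add: total_zeros_Suc del: of_nat_Suc)
  qed
qed

section \<open>Sums symmetric about the middle\<close>

lemma sum_choose_lower_half: "(2 * h choose h) + 2 * (\<Sum>k<h. 2 * h choose k) = 2 ^ (2 * h)"
proof -
  have split: "{..2 * h} = {..<h} \<union> {h} \<union> {h<..2 * h}" by auto
  have "(\<Sum>k\<in>{h<..2 * h}. 2 * h choose k) = (\<Sum>k<h. 2 * h choose k)"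
    by (rule sum.reindex_bij_witness[of _ "\<lambda>k. 2 * h - k" "\<lambda>k. 2 * h - k"])
      (auto simp: binomial_symmetric[symmetric])
  moreover have "(\<Sum>k\<le>2 * h. 2 * h choose k) =
      (\<Sum>k<h. 2 * h choose k) + (2 * h choose h) + (\<Sum>k\<in>{h<..2 * h}. 2 * h choose k)"
    unfolding split by (subst sum.union_disjoint; auto)+
  ultimately show ?thesis using choose_row_sum[of "2 * h"] by simp
qed

text \<open>The reflection \<open>j\<close> to \<open>n - j\<close> swaps the two halves and fixes
  only \<open>n div 2\<close>, for even \<open>n\<close>.\<close>

lemma sum_symmetric_halves:
  fixes f :: "nat \<Rightarrow> real"
  assumes "\<And>j. j \<le> n \<Longrightarrow> f (n - j) = f j"
  shows "(\<Sum>j\<le>n. f j) = 2 * (\<Sum>j | 2 * j < n. f j) + of_bool (even n) * f (n div 2)"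
proof -
  have split: "{..n} = {j. 2 * j < n} \<union> {j. 2 * j = n} \<union> {j. n < 2 * j \<and> j \<le> n}" by auto
  have fin: "finite {j. 2 * j < n}" by (rule finite_subset[of _ "{..n}"]) auto
  have mid: "{j. 2 * j = n} = (if even n then {n div 2} else {})" by auto
  have "(\<Sum>j | n < 2 * j \<and> j \<le> n. f j) = (\<Sum>j | 2 * j < n. f j)"
    by (rule sum.reindex_bij_witness[of _ "\<lambda>j. n - j" "\<lambda>j. n - j"]) (auto simp: assms)
  moreover have "(\<Sum>j\<le>n. f j) = (\<Sum>j | 2 * j < n. f j) + (\<Sum>j | 2 * j = n. f j) +
      (\<Sum>j | n < 2 * j \<and> j \<le> n. f j)"
    unfolding split using fin
    by (subst sum.union_disjoint; (subst sum.union_disjoint)?; auto simp: mid)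
  ultimately show ?thesis by (simp add: mid)
qed

section \<open>Expected number of zeros\<close>

lemma expectation_zeros_given_start:
  assumes "j \<le> n"
  shows "measure_pmf.expectation (pmf_of_set (lattice_paths (0, 2 * int j - int n) (int n, 0)))
    (\<lambda>p. real (card (zeros p))) = total_zeros n j / (n choose j)"
proof -
  let ?L = "lattice_paths (0, 2 * int j - int n) (int n, 0)"
  have card: "card ?L = n choose j" using card_lattice_paths[of 0 j n] by simp
  have "finite ?L" using finite_lattice_paths[of 0 _ n] by simp
  moreover have "?L \<noteq> {}" using card assms by (metis card.empty zero_less_binomial less_irrefl)
  ultimately show ?thesis
    using sum_card_zeros[of 0 j n] card
    by (simp add: integral_pmf_of_set flip: of_nat_sum)
qed

text \<open>The start heights are \<open>2 * j - n\<close> for the \<open>n + 1\<close> values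
  \<open>j \<le> n\<close>, so their uniform choice is an average over \<open>j\<close>.\<close>

lemma expectation_zeros:
  "measure_pmf.expectation (random_path n) (\<lambda>p. real (card (zeros p))) =
    (\<Sum>j\<le>n. total_zeros n j / (n choose j)) / (n + 1)"
proof -
  let ?h = "\<lambda>j. 2 * int j - int n"
  have heights: "start_heights n = ?h ` {..n}"
    by (auto simp: start_heights_def)
  have inj: "inj_on ?h {..n}" by (auto simp: inj_on_def)
  have fin: "finite (lattice_paths (0, ?h j) (int n, 0))" for j
    using finite_lattice_paths[of 0 _ n] by simp
  have ne: "lattice_paths (0, ?h j) (int n, 0) \<noteq> {}" if "j \<le> n" for j
    using card_lattice_paths[of 0 j n] that by (metis add_0 card.empty zero_less_binomial less_irrefl)
  have "measure_pmf.expectation (random_path n) (\<lambda>p. real (card (zeros p))) =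
    (\<Sum>s\<in>start_heights n. measure_pmf.expectation (pmf_of_set (lattice_paths (0, s) (int n, 0)))
      (\<lambda>p. real (card (zeros p))) / card (start_heights n))"
    unfolding random_path_def
    by (subst pmf_expectation_bind_pmf_of_set) (auto simp: heights fin ne divide_inverse_commute)
  also have "\<dots> = (\<Sum>j\<le>n. total_zeros n j / (n choose j) / (n + 1))"
    unfolding heights by (subst sum.reindex[OF inj])
      (simp add: card_image[OF inj] expectation_zeros_given_start add.commute)
  finally show ?thesis by (simp add: sum_divide_distrib add.commute)
qed

theorem theoremA1:
  fixes n :: nat
  shows "measure_pmf.expectation (random_path n) (\<lambda>p. real (card (zeros p))) =
    4 / (real n + 1) *
      (\<Sum>(k, l) \<in> {(k :: nat, l :: nat). k < l \<and> int l < \<lceil>real n / 2\<rceil>}.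
         real (n choose k) / real (n choose l))
    + of_bool (even n) * (1 / (real n + 1) * (2 ^ n / real (n choose (n div 2)) - 1))
    + 1"
proof -
  define f where "f j = (\<Sum>k<min j (n - j). real (n choose k)) / real (n choose j)" for j
  have "total_zeros n j / (n choose j) = 1 + 2 * f j" if "j \<le> n" for j
    using that by (simp add: total_zeros_def f_def add_divide_distrib)
  then have total: "(\<Sum>j\<le>n. total_zeros n j / (n choose j)) = real n + 1 + 2 * (\<Sum>j\<le>n. f j)"
    by (simp add: sum.distrib sum_distrib_left)
  have halves: "(\<Sum>j\<le>n. f j) = 2 * (\<Sum>j | 2 * j < n. f j) + of_bool (even n) * f (n div 2)"
    by (rule sum_symmetric_halves) (simp add: f_def min.commute binomial_symmetric[symmetric])
  \<comment> \<open>At the middle index, \<open>f\<close> sums exactly the lower half of the row,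
    which \<open>sum_choose_lower_half\<close> evaluates.\<close>
  have middle: "2 * f (n div 2) = 2 ^ n / real (n choose (n div 2)) - 1" if "even n"
  proof -
    from that obtain h where n: "n = 2 * h" by blast
    have "(2 * h choose h) > 0" by simp
    then show ?thesis
      using arg_cong[OF sum_choose_lower_half[of h], of real] n
      by (simp add: f_def field_simps)
  qed
  \<comment> \<open>The ceiling condition says \<open>2 * l < n\<close>; the pairs are grouped by
    \<open>l\<close>, the index of the denominator.\<close>
  have index: "{(k, l). k < l \<and> int l < \<lceil>real n / 2\<rceil>} =
      (\<lambda>(l, k). (k, l)) ` (SIGMA l : {l. 2 * l < n}. {..<l})"
    by (auto simp: less_ceiling_iff)
  have "finite {l. 2 * l < n}" by (rule finite_subset[of _ "{..n}"]) auto
  then have "(\<Sum>(k, l) \<in> {(k, l). k < l \<and> int l < \<lceil>real n / 2\<rceil>}.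
      real (n choose k) / real (n choose l)) =
      (\<Sum>l | 2 * l < n. \<Sum>k<l. real (n choose k) / real (n choose l))"
    unfolding index by (subst sum.reindex) (auto simp: inj_on_def sum.Sigma case_prod_beta)
  also have "\<dots> = (\<Sum>l | 2 * l < n. f l)"
    by (intro sum.cong) (auto simp: f_def sum_divide_distrib min_def)
  finally have pairs: "(\<Sum>(k, l) \<in> {(k, l). k < l \<and> int l < \<lceil>real n / 2\<rceil>}.
      real (n choose k) / real (n choose l)) = (\<Sum>l | 2 * l < n. f l)" .
  \<comment> \<open>The factor 4 combines the 2 in \<open>total_zeros\<close> with the 2 from the
    halves; the middle term keeps only the first of these.\<close>
  show ?thesis
    unfolding expectation_zeros total halves pairs
    using middle by (cases "even n") (simp_all add: add_divide_distrib flip: middle)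
qed

end
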